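(* The backward Euler scheme is unconditionally stable: if $U_{ms}^n\in V_{ms}$ satisfies $$\Big(\frac{U_{ms}^n-U_{ms}^{n-1}}{\Delta t},v\Big)+a(U_{ms}^n,v)=(f(t_n),v)\quad\forall v\in V_{ms},\ n\ge1,\qquad U_{ms}^0=u_{0,ms},$$ then, for every time step $\Delta t>0$ and every $n\ge1$, $$\|U_{ms}^n\|\le\|U_{ms}^0\|+\Delta t\sum_{j=1}^n\|f^j\|.$$
   Context: $\Omega\subset\mathbb{R}^d$ ($d=2,3$) is a bounded domain; $0<\kappa_0\le\kappa(x)\le\kappa_1<\infty$ in $\Omega$. $V=H^1(\Omega)$, $a(u,v)=\int_\Omega\kappa\nabla u\cdot\nabla v$, $(f,v)=\int_\Omega fv$, $\|\cdot\|$ is the $L^2(\Omega)$ norm. $t_n=n\Delta t$, $f^n=f(t_n)\in L^2(\Omega)$. $u_{0,ms}\in V_{ms}$ is the $L^2(\Omega)$ projection of the initial datum $u_0$ onto $V_{ms}$. Multiscale space $V_{ms}\subset H_0^1(\Omega)$ (finite dimensional). Let $\mathcal{T}^H$ be a conforming finite element coarse partition of $\Omega$ of mesh size $H$ with elements $K_1,\dots,K_N$ and vertices $x_1,\dots,x_{N_c}$, and let $\{\chi_j\}_{j=1}^{N_c}$ be partition of unity functions for $\mathcal{T}^H$. Put $\widetilde\kappa=\kappa\sum_{j=1}^{N_c}|\nabla\chi_j|^2$. In each $K_i$ let $(\lambda_j^{(i)},\phi_j^{(i)})$, $\lambda_1^{(i)}\le\lambda_2^{(i)}\le\cdots$, be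 the eigenpairs of $\int_{K_i}\kappa\nabla\phi_j^{(i)}\cdot\nabla v=\lambda_j^{(i)}s_i(\phi_j^{(i)},v)$ for all $v\in H^1(K_i)$, where $s_i(u,v)=\int_{K_i}\widetilde\kappa uv$ and $s_i(\phi_j^{(i)},\phi_j^{(i)})=1$. For chosen integers $L_i$, $V_{aux}^{(i)}=\mathrm{span}\{\phi_j^{(i)}:1\le j\le L_i\}$ and $V_{aux}=\bigoplus_{i=1}^N V_{aux}^{(i)}$ (functions extended by zero outside $K_i$). Let $s(u,v)=\sum_{i=1}^N s_i(u,v)$. A function $\psi\in V$ is called $\phi_j^{(i)}$-orthogonal if $s(\psi,\phi_j^{(i)})=1$ and $s(\psi,\phi_{j'}^{(i')})=0$ whenever $j'\ne j$ or $i'\ne i$ (over the basis functions of $V_{aux}$). $K_{i,m}\subset\Omega$ is the oversampling region obtained by enlarging $K_i$ by $m$ coarse grid layers. The basis functions are $\psi_{j,ms}^{(i)}=\mathrm{argmin}\{a(\psi,\psi):\psi\in H_0^1(K_{i,m}),\ \psi\text{ is }\phi_j^{(i)}\text{-orthogonal}\}$ (extended by zero), and $V_{ms}=\mathrm{span}\{\psi_{j,ms}^{(i)}:1\le j\le L_i,\ 1\le i\le N\}$. *)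

theory Defs
  imports "HOL-Analysis.Analysis"
begin

text \<open>
  Elements of \<open>L\<^sup>2(D)\<close> and \<open>H\<^sup>1(D)\<close> are represented by functions on the whole space; only
  their values in \<open>D\<close>, up to Lebesgue null sets, matter.
\<close>

definition L2 :: "(real^'n) set \<Rightarrow> (real^'n \<Rightarrow> real) set" where
  "L2 D = {u \<in> borel_measurable (lebesgue_on D). integrable (lebesgue_on D) (\<lambda>x. (u x)\<^sup>2)}"

definition L2_inner :: "(real^'n) set \<Rightarrow> (real^'n \<Rightarrow> real) \<Rightarrow> (real^'n \<Rightarrow> real) \<Rightarrow> real" where
  "L2_inner D u v = (LINT x|lebesgue_on D. u x * v x)"

definition L2_norm :: "(real^'n) set \<Rightarrow> (real^'n \<Rightarrow> real) \<Rightarrow> real" where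
  "L2_norm D u = sqrt (L2_inner D u u)"

definition partial_deriv :: "'n \<Rightarrow> (real^'n \<Rightarrow> real) \<Rightarrow> real^'n \<Rightarrow> real" where
  "partial_deriv k f x = frechet_derivative f (at x) (axis k 1)"

primrec Ck :: "nat \<Rightarrow> (real^'n \<Rightarrow> real) \<Rightarrow> bool" where
  "Ck 0 f \<longleftrightarrow> continuous_on UNIV f"
| "Ck (Suc r) f \<longleftrightarrow> (\<forall>x. f differentiable (at x)) \<and> (\<forall>k. Ck r (partial_deriv k f))"

text \<open>The test functions \<open>C\<^sub>c\<^sup>\<infinity>(D)\<close>, extended by zero.\<close>

definition test_fun :: "(real^'n) set \<Rightarrow> (real^'n \<Rightarrow> real) \<Rightarrow> bool" where
  "test_fun D p \<longleftrightarrow> (\<forall>r. Ck r p) \<and> compact (closure {x. p x \<noteq> 0}) \<and> closure {x. p x \<noteq> 0} \<subseteq> D"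

definition has_weak_grad :: "(real^'n) set \<Rightarrow> (real^'n \<Rightarrow> real) \<Rightarrow> (real^'n \<Rightarrow> real^'n) \<Rightarrow> bool" where
  "has_weak_grad D u g \<longleftrightarrow>
     (\<forall>k. (\<lambda>x. g x $ k) \<in> L2 D) \<and>
     (\<forall>p k. test_fun D p \<longrightarrow>
        L2_inner D u (partial_deriv k p) = - L2_inner D (\<lambda>x. g x $ k) p)"

definition H1 :: "(real^'n) set \<Rightarrow> (real^'n \<Rightarrow> real) set" where
  "H1 D = {u \<in> L2 D. \<exists>g. has_weak_grad D u g}"

text \<open>For \<open>u \<in> H1 D\<close> with \<open>D\<close> open this is the weak gradient, unique up to null sets in \<open>D\<close>.\<close>

definition weak_grad :: "(real^'n) set \<Rightarrow> (real^'n \<Rightarrow> real) \<Rightarrow> real^'n \<Rightarrow> real^'n" where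
  "weak_grad D u = (SOME g. has_weak_grad D u g)"

definition H1_norm :: "(real^'n) set \<Rightarrow> (real^'n \<Rightarrow> real) \<Rightarrow> real" where
  "H1_norm D u = sqrt ((L2_norm D u)\<^sup>2 + (LINT x|lebesgue_on D. (norm (weak_grad D u x))\<^sup>2))"

definition H10 :: "(real^'n) set \<Rightarrow> (real^'n \<Rightarrow> real) set" where
  "H10 D = {u \<in> H1 D. \<exists>p. (\<forall>n. test_fun D (p n)) \<and>
                 (\<lambda>n. H1_norm D (\<lambda>x. u x - p n x)) \<longlonglongrightarrow> 0}"

text \<open>\<open>H\<^sub>0\<^sup>1(D)\<close> for \<open>D \<subseteq> \<Omega>\<close>, its elements extended by zero to \<open>\<Omega>\<close>.\<close>

definition H10_ext :: "(real^'n) set \<Rightarrow> (real^'n) set \<Rightarrow> (real^'n \<Rightarrow> real) set" where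
  "H10_ext \<Omega> D = {u \<in> H10 D. AE x in lebesgue_on (\<Omega> - D). u x = 0}"

definition energy :: "(real^'n) set \<Rightarrow> (real^'n \<Rightarrow> real) \<Rightarrow> (real^'n \<Rightarrow> real) \<Rightarrow> (real^'n \<Rightarrow> real) \<Rightarrow> real" where
  "energy D \<kappa> u v = (LINT x|lebesgue_on D. \<kappa> x * (weak_grad D u x \<bullet> weak_grad D v x))"

definition bounded_domain :: "(real^'n) set \<Rightarrow> bool" where
  "bounded_domain \<Omega> \<longleftrightarrow> open \<Omega> \<and> connected \<Omega> \<and> bounded \<Omega> \<and> \<Omega> \<noteq> {}"

text \<open>
  Elements are closed convex polytopes (triangles, quadrilaterals, tetrahedra, hexahedra, ...);
  conformity means that two elements meet in a common, possibly empty, face.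
\<close>

definition conforming_partition :: "(real^'n) set \<Rightarrow> nat \<Rightarrow> (nat \<Rightarrow> (real^'n) set) \<Rightarrow> real \<Rightarrow> bool" where
  "conforming_partition \<Omega> N K H \<longleftrightarrow>
     (\<forall>i\<in>{1..N}. polytope (K i) \<and> interior (K i) \<noteq> {} \<and> interior (K i) \<subseteq> \<Omega>) \<and>
     (\<Union>i\<in>{1..N}. K i) = closure \<Omega> \<and>
     (\<forall>i\<in>{1..N}. \<forall>j\<in>{1..N}. i \<noteq> j \<longrightarrow>
        interior (K i) \<inter> interior (K j) = {} \<and>
        (K i \<inter> K j) face_of K i \<and> (K i \<inter> K j) face_of K j) \<and>
     H = Max ((\<lambda>i. diameter (K i)) ` {1..N})"

definition mesh_vertices :: "nat \<Rightarrow> (nat \<Rightarrow> (real^'n) set) \<Rightarrow> (real^'n) set" where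
  "mesh_vertices N K = (\<Union>i\<in>{1..N}. {x. x extreme_point_of K i})"

definition vertex_patch :: "nat \<Rightarrow> (nat \<Rightarrow> (real^'n) set) \<Rightarrow> real^'n \<Rightarrow> (real^'n) set" where
  "vertex_patch N K x = (\<Union>i\<in>{i\<in>{1..N}. x \<in> K i}. K i)"

definition partition_of_unity ::
  "(real^'n) set \<Rightarrow> nat \<Rightarrow> (nat \<Rightarrow> (real^'n) set) \<Rightarrow> nat \<Rightarrow> (nat \<Rightarrow> real^'n) \<Rightarrow> (nat \<Rightarrow> real^'n \<Rightarrow> real) \<Rightarrow> bool" where
  "partition_of_unity \<Omega> N K Nc xv pou \<longleftrightarrow>
     (\<forall>j\<in>{1..Nc}. pou j \<in> H1 \<Omega> \<and>
        (AE x in lebesgue_on \<Omega>. 0 \<le> pou j x \<and> (x \<notin> vertex_patch N K (xv j) \<longrightarrow> pou j x = 0))) \<and>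
     (AE x in lebesgue_on \<Omega>. (\<Sum>j=1..Nc. pou j x) = 1)"

definition kappa_tilde ::
  "(real^'n) set \<Rightarrow> (real^'n \<Rightarrow> real) \<Rightarrow> nat \<Rightarrow> (nat \<Rightarrow> real^'n \<Rightarrow> real) \<Rightarrow> real^'n \<Rightarrow> real" where
  "kappa_tilde \<Omega> \<kappa> Nc pou x = \<kappa> x * (\<Sum>j=1..Nc. (norm (weak_grad \<Omega> (pou j) x))\<^sup>2)"

definition s_loc :: "(real^'n) set \<Rightarrow> (real^'n \<Rightarrow> real) \<Rightarrow> (real^'n \<Rightarrow> real) \<Rightarrow> (real^'n \<Rightarrow> real) \<Rightarrow> real" where
  "s_loc D w u v = (LINT x|lebesgue_on D. w x * u x * v x)"

text \<open>
  The partition of unity is only assumed to be in \<open>H\<^sup>1\<close>, so the weight \<open>w\<close> need not be bounded;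
  the integrability clause says that the right-hand side of the eigenvalue problem is
  well defined (it is automatic for Lipschitz partitions of unity).
\<close>

definition weak_eigenpair ::
  "(real^'n) set \<Rightarrow> (real^'n \<Rightarrow> real) \<Rightarrow> (real^'n \<Rightarrow> real) \<Rightarrow> real \<Rightarrow> (real^'n \<Rightarrow> real) \<Rightarrow> bool" where
  "weak_eigenpair D \<kappa> w lam \<phi> \<longleftrightarrow>
     \<phi> \<in> H1 D \<and>
     (\<forall>v\<in>H1 D. integrable (lebesgue_on D) (\<lambda>x. w x * \<phi> x * v x) \<and>
               energy D \<kappa> \<phi> v = lam * s_loc D w \<phi> v)"

text \<open>
  \<open>(lam j, \<phi> j)\<close>, \<open>j \<ge> 1\<close>, lists all eigenpairs in nondecreasing order, each eigenvalue repeated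
  according to its multiplicity: the \<open>\<phi> j\<close> are linearly independent and those belonging to an
  eigenvalue span its eigenspace.
\<close>

definition ordered_eigenpairs ::
  "(real^'n) set \<Rightarrow> (real^'n \<Rightarrow> real) \<Rightarrow> (real^'n \<Rightarrow> real) \<Rightarrow> (nat \<Rightarrow> real) \<Rightarrow> (nat \<Rightarrow> real^'n \<Rightarrow> real) \<Rightarrow> bool" where
  "ordered_eigenpairs D \<kappa> w lam \<phi> \<longleftrightarrow>
     (\<forall>j\<ge>1. weak_eigenpair D \<kappa> w (lam j) (\<phi> j) \<and> s_loc D w (\<phi> j) (\<phi> j) = 1) \<and>
     (\<forall>j\<ge>1. lam j \<le> lam (Suc j)) \<and>
     (\<forall>n c. (AE x in lebesgue_on D. (\<Sum>j=1..n. c j * \<phi> j x) = 0) \<longrightarrow> (\<forall>j\<in>{1..n}. c j = 0)) \<and>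
     (\<forall>\<mu> u. weak_eigenpair D \<kappa> w \<mu> u \<longrightarrow>
        (\<exists>J c. finite J \<and> J \<subseteq> {j. 1 \<le> j \<and> lam j = \<mu>} \<and>
               (AE x in lebesgue_on D. u x = (\<Sum>j\<in>J. c j * \<phi> j x))))"

definition zero_ext :: "(real^'n) set \<Rightarrow> (real^'n \<Rightarrow> real) \<Rightarrow> real^'n \<Rightarrow> real" where
  "zero_ext D u x = (if x \<in> D then u x else 0)"

definition s_form ::
  "nat \<Rightarrow> (nat \<Rightarrow> (real^'n) set) \<Rightarrow> (real^'n \<Rightarrow> real) \<Rightarrow> (real^'n \<Rightarrow> real) \<Rightarrow> (real^'n \<Rightarrow> real) \<Rightarrow> real" where
  "s_form N K w u v = (\<Sum>i=1..N. s_loc (interior (K i)) w u v)"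

definition phi_orthogonal ::
  "nat \<Rightarrow> (nat \<Rightarrow> (real^'n) set) \<Rightarrow> (real^'n \<Rightarrow> real) \<Rightarrow> (nat \<Rightarrow> nat) \<Rightarrow> (nat \<Rightarrow> nat \<Rightarrow> real^'n \<Rightarrow> real)
   \<Rightarrow> nat \<Rightarrow> nat \<Rightarrow> (real^'n \<Rightarrow> real) \<Rightarrow> bool" where
  "phi_orthogonal N K w L \<phi> i j \<psi> \<longleftrightarrow>
     s_form N K w \<psi> (zero_ext (interior (K i)) (\<phi> i j)) = 1 \<and>
     (\<forall>i'\<in>{1..N}. \<forall>j'\<in>{1..L i'}. j' \<noteq> j \<or> i' \<noteq> i \<longrightarrow>
        s_form N K w \<psi> (zero_ext (interior (K i')) (\<phi> i' j')) = 0)"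

primrec layers :: "nat \<Rightarrow> (nat \<Rightarrow> (real^'n) set) \<Rightarrow> nat \<Rightarrow> nat \<Rightarrow> (real^'n) set" where
  "layers N K i 0 = K i"
| "layers N K i (Suc m) = (\<Union>j\<in>{j\<in>{1..N}. K j \<inter> layers N K i m \<noteq> {}}. K j)"

text \<open>The closed union of elements is replaced by an open subset of \<open>\<Omega>\<close>, on which \<open>H\<^sub>0\<^sup>1\<close> makes sense.\<close>

definition oversampling_region ::
  "(real^'n) set \<Rightarrow> nat \<Rightarrow> (nat \<Rightarrow> (real^'n) set) \<Rightarrow> nat \<Rightarrow> nat \<Rightarrow> (real^'n) set" where
  "oversampling_region \<Omega> N K i m = \<Omega> \<inter> interior (layers N K i m)"

definition is_ms_basis ::
  "(real^'n) set \<Rightarrow> (real^'n \<Rightarrow> real) \<Rightarrow> nat \<Rightarrow> (nat \<Rightarrow> (real^'n) set) \<Rightarrow> (real^'n \<Rightarrow> real) \<Rightarrow> (nat \<Rightarrow> nat)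
   \<Rightarrow> (nat \<Rightarrow> nat \<Rightarrow> real^'n \<Rightarrow> real) \<Rightarrow> nat \<Rightarrow> (nat \<Rightarrow> nat \<Rightarrow> real^'n \<Rightarrow> real) \<Rightarrow> bool" where
  "is_ms_basis \<Omega> \<kappa> N K w L \<phi> m \<psi> \<longleftrightarrow>
     (\<forall>i\<in>{1..N}. \<forall>j\<in>{1..L i}.
        is_arg_min (\<lambda>p. energy \<Omega> \<kappa> p p)
          (\<lambda>p. p \<in> H10_ext \<Omega> (oversampling_region \<Omega> N K i m) \<and> phi_orthogonal N K w L \<phi> i j p)
          (\<psi> i j))"

definition ms_space ::
  "(real^'n) set \<Rightarrow> nat \<Rightarrow> (nat \<Rightarrow> nat) \<Rightarrow> (nat \<Rightarrow> nat \<Rightarrow> real^'n \<Rightarrow> real) \<Rightarrow> (real^'n \<Rightarrow> real) set" where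
  "ms_space \<Omega> N L \<psi> = {u \<in> H1 \<Omega>. \<exists>c. AE x in lebesgue_on \<Omega>.
      u x = (\<Sum>i=1..N. \<Sum>j=1..L i. c i j * \<psi> i j x)}"

definition is_L2_projection ::
  "(real^'n) set \<Rightarrow> (real^'n \<Rightarrow> real) set \<Rightarrow> (real^'n \<Rightarrow> real) \<Rightarrow> (real^'n \<Rightarrow> real) \<Rightarrow> bool" where
  "is_L2_projection \<Omega> W u p \<longleftrightarrow> p \<in> W \<and> (\<forall>v\<in>W. L2_inner \<Omega> p v = L2_inner \<Omega> u v)"

end

theory Submission
  imports Defs
begin

text \<open>
  Testing with \<open>v = U\<^sup>n\<close> and dropping \<open>a(U\<^sup>n, U\<^sup>n) \<ge> 0\<close> gives
  \<open>\<parallel>U\<^sup>n\<parallel>\<^sup>2 \<le> (U\<^sup>n\<^sup>-\<^sup>1, U\<^sup>n) + \<Delta>t (f\<^sup>n, U\<^sup>n)\<close>. By Cauchy-Schwarz one factor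
  \<open>\<parallel>U\<^sup>n\<parallel>\<close> cancels, and the resulting one-step bound is summed over the time steps.
\<close>

text \<open>The product is dominated by the integrable function
  \<open>(u x)\<^sup>2 + (v x)\<^sup>2\<close>. It is what lets integrals of products be split by
  linearity below.\<close>

lemma L2_mult_integrable:
  assumes "u \<in> L2 D" "v \<in> L2 D"
  shows "integrable (lebesgue_on D) (\<lambda>x. u x * v x)"
proof (rule Bochner_Integration.integrable_bound)
  show "integrable (lebesgue_on D) (\<lambda>x. (u x)\<^sup>2 + (v x)\<^sup>2)"
    using assms by (simp add: L2_def)
  show "(\<lambda>x. u x * v x) \<in> borel_measurable (lebesgue_on D)"
    using assms by (intro borel_measurable_times) (auto simp: L2_def)
  have "norm (a * b) \<le> norm (a\<^sup>2 + b\<^sup>2)" for a b :: real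
    using sum_squares_bound[of "\<bar>a\<bar>" "\<bar>b\<bar>"] abs_ge_zero[of "a * b"]
    unfolding real_norm_def abs_mult power2_abs mult.assoc by linarith
  then show "AE x in lebesgue_on D. norm (u x * v x) \<le> norm ((u x)\<^sup>2 + (v x)\<^sup>2)"
    by simp
qed

lemma L2_inner_self_nonneg: "0 \<le> L2_inner D u u"
  by (simp add: L2_inner_def)

lemma L2_norm_nonneg: "0 \<le> L2_norm D u"
  by (simp add: L2_norm_def L2_inner_self_nonneg)

lemma L2_norm_power2: "(L2_norm D u)\<^sup>2 = L2_inner D u u"
  by (simp add: L2_norm_def L2_inner_self_nonneg)

text \<open>Cauchy-Schwarz by the discriminant argument: the integral of
  \<open>(u x - t * v x)\<^sup>2\<close> is a quadratic in \<open>t\<close> that never becomes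
  negative.\<close>

lemma L2_inner_le_norms:
  assumes "u \<in> L2 D" "v \<in> L2 D"
  shows "L2_inner D u v \<le> L2_norm D u * L2_norm D v"
proof -
  let ?A = "L2_inner D u u" and ?B = "L2_inner D u v" and ?C = "L2_inner D v v"
  note int = L2_mult_integrable[OF assms(1) assms(1)] L2_mult_integrable[OF assms]
    L2_mult_integrable[OF assms(2) assms(2)]
  have quadratic: "0 \<le> ?C * t\<^sup>2 + (- 2 * ?B) * t + ?A" for t
  proof -
    have "0 \<le> (LINT x|lebesgue_on D. (u x - t * v x)\<^sup>2)"
      by simp
    also have "\<dots> = (LINT x|lebesgue_on D. u x * u x - 2 * t * (u x * v x) + t\<^sup>2 * (v x * v x))"
      by (rule Bochner_Integration.integral_cong) (auto simp: power2_eq_square algebra_simps)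
    also have "\<dots> = ?A - 2 * t * ?B + t\<^sup>2 * ?C"
      using int by (simp add: L2_inner_def)
    finally show ?thesis
      by (simp add: algebra_simps)
  qed
  have "?B\<^sup>2 \<le> ?A * ?C"
  proof (cases "?C = 0")
    case True
    have "?B = 0"
    proof (rule ccontr)
      assume "?B \<noteq> 0"
      \<comment> \<open>With \<open>?C = 0\<close> the quadratic is affine in \<open>t\<close>; this
        \<open>t\<close> is chosen so that its value is -1.\<close>
      then show False
        using quadratic[of "(?A + 1) / (2 * ?B)"] True by simp
    qed
    then show ?thesis
      using True by simp
  next
    case False
    then have C: "0 < ?C"
      using L2_inner_self_nonneg[of D v] by simp
    \<comment> \<open>\<open>?B / ?C\<close> is the minimiser of the quadratic, so this value gives
      the sharpest bound.\<close>
    have "?C * (?B / ?C)\<^sup>2 + (- 2 * ?B) * (?B / ?C) + ?A = ?A - ?B\<^sup>2 / ?C"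
      using C by (simp add: field_simps power2_eq_square)
    then have "?B\<^sup>2 / ?C \<le> ?A"
      using quadratic[of "?B / ?C"] by linarith
    then show ?thesis
      using C by (simp add: pos_divide_le_eq)
  qed
  then have "\<bar>?B\<bar> \<le> sqrt (?A * ?C)"
    using real_le_rsqrt by fastforce
  then show ?thesis
    by (simp add: L2_norm_def real_sqrt_mult)
qed

text \<open>The integrand is \<open>\<kappa> x\<close> times a squared norm, whichever weak gradient
  \<open>SOME\<close> selects. Should it fail to be integrable, the integral is 0 by convention, so
  the sign persists.\<close>

lemma energy_self_nonneg:
  assumes "D \<in> sets lebesgue" "\<forall>x\<in>D. 0 \<le> \<kappa> x"
  shows "0 \<le> energy D \<kappa> u u"
  unfolding energy_def using assms
  by (intro integral_nonneg_AE AE_I2) auto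

text \<open>One time step in isolation: \<open>step\<close> is the scheme tested with
  \<open>u\<close> itself after the energy term has been dropped, so only the L2 structure
  remains.\<close>

lemma backward_euler_step:
  assumes u: "u \<in> L2 D" and u': "u' \<in> L2 D" and g: "g \<in> L2 D" and "0 < \<tau>"
    and step: "L2_inner D (\<lambda>x. (u x - u' x) / \<tau>) u \<le> L2_inner D g u"
  shows "L2_norm D u \<le> L2_norm D u' + \<tau> * L2_norm D g"
proof -
  have "L2_inner D (\<lambda>x. (u x - u' x) / \<tau>) u
      = (LINT x|lebesgue_on D. (u x * u x - u' x * u x) / \<tau>)"
    by (simp add: L2_inner_def algebra_simps)
  also have "\<dots> = (L2_inner D u u - L2_inner D u' u) / \<tau>"
    using L2_mult_integrable[OF u u] L2_mult_integrable[OF u' u] by (simp add: L2_inner_def)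
  finally have "(L2_inner D u u - L2_inner D u' u) / \<tau> \<le> L2_inner D g u"
    using step by simp
  then have "L2_inner D u u \<le> L2_inner D u' u + \<tau> * L2_inner D g u"
    using \<open>0 < \<tau>\<close> by (simp add: pos_divide_le_eq algebra_simps)
  also have "\<dots> \<le> L2_norm D u' * L2_norm D u + \<tau> * (L2_norm D g * L2_norm D u)"
    using \<open>0 < \<tau>\<close> u u' g by (intro add_mono mult_left_mono L2_inner_le_norms) auto
  finally have "L2_norm D u * L2_norm D u \<le> (L2_norm D u' + \<tau> * L2_norm D g) * L2_norm D u"
    by (simp add: L2_norm_power2[symmetric] power2_eq_square algebra_simps)
  \<comment> \<open>The common factor \<open>L2_norm D u\<close> can be cancelled only if it is
    nonzero; if it vanishes, the bound holds because its right-hand side is nonnegative.\<close>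
  then show ?thesis
    using L2_norm_nonneg[of D u] L2_norm_nonneg[of D u'] L2_norm_nonneg[of D g] \<open>0 < \<tau>\<close>
    by (cases "L2_norm D u = 0") auto
qed

theorem mainTheorem9:
  fixes \<Omega> :: "(real^'n) set" and \<kappa> :: "real^'n \<Rightarrow> real" and \<kappa>0 \<kappa>1 :: real
    and N Nc :: nat and K :: "nat \<Rightarrow> (real^'n) set" and H :: real
    and xv :: "nat \<Rightarrow> real^'n" and pou :: "nat \<Rightarrow> real^'n \<Rightarrow> real"
    and lam :: "nat \<Rightarrow> nat \<Rightarrow> real" and \<phi> :: "nat \<Rightarrow> nat \<Rightarrow> real^'n \<Rightarrow> real"
    and L :: "nat \<Rightarrow> nat" and m :: nat and \<psi> :: "nat \<Rightarrow> nat \<Rightarrow> real^'n \<Rightarrow> real"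
    and Vms :: "(real^'n \<Rightarrow> real) set"
    and f :: "real \<Rightarrow> real^'n \<Rightarrow> real" and u0 u0ms :: "real^'n \<Rightarrow> real"
    and U :: "nat \<Rightarrow> real^'n \<Rightarrow> real" and \<Delta>t :: real
  assumes dim: "CARD('n) = 2 \<or> CARD('n) = 3"
    and domain: "bounded_domain \<Omega>"
    and kappa_measurable: "\<kappa> \<in> borel_measurable (lebesgue_on \<Omega>)"
    and kappa_bounds: "0 < \<kappa>0" "\<forall>x\<in>\<Omega>. \<kappa>0 \<le> \<kappa> x \<and> \<kappa> x \<le> \<kappa>1"
    and mesh: "conforming_partition \<Omega> N K H"
    and vertices: "bij_betw xv {1..Nc} (mesh_vertices N K)"
    and pou_functions: "partition_of_unity \<Omega> N K Nc xv pou"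
    and eigen: "\<forall>i\<in>{1..N}. ordered_eigenpairs (interior (K i)) \<kappa> (kappa_tilde \<Omega> \<kappa> Nc pou) (lam i) (\<phi> i)"
    and basis: "is_ms_basis \<Omega> \<kappa> N K (kappa_tilde \<Omega> \<kappa> Nc pou) L \<phi> m \<psi>"
    and Vms: "Vms = ms_space \<Omega> N L \<psi>"
    and time_step: "0 < \<Delta>t"
    and source: "\<forall>n\<ge>1. f (real n * \<Delta>t) \<in> L2 \<Omega>"
    and initial: "u0 \<in> L2 \<Omega>" "is_L2_projection \<Omega> Vms u0 u0ms"
    and U_in: "\<forall>n. U n \<in> Vms"
    and U_0: "AE x in lebesgue_on \<Omega>. U 0 x = u0ms x"
    and scheme: "\<forall>n\<ge>1. \<forall>v\<in>Vms.
      L2_inner \<Omega> (\<lambda>x. (U n x - U (n - 1) x) / \<Delta>t) v + energy \<Omega> \<kappa> (U n) v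
        = L2_inner \<Omega> (f (real n * \<Delta>t)) v"
  shows "\<forall>n\<ge>1. L2_norm \<Omega> (U n)
      \<le> L2_norm \<Omega> (U 0) + \<Delta>t * (\<Sum>j=1..n. L2_norm \<Omega> (f (real j * \<Delta>t)))"
proof -
  have U_L2: "U n \<in> L2 \<Omega>" for n
    using U_in Vms by (auto simp: ms_space_def H1_def)
  have "\<Omega> \<in> sets lebesgue"
    using domain by (auto simp: bounded_domain_def)
  moreover have "\<forall>x\<in>\<Omega>. 0 \<le> \<kappa> x"
    using kappa_bounds by force
  ultimately have energy: "0 \<le> energy \<Omega> \<kappa> (U n) (U n)" for n
    by (rule energy_self_nonneg)
  have step: "L2_norm \<Omega> (U (Suc n))
      \<le> L2_norm \<Omega> (U n) + \<Delta>t * L2_norm \<Omega> (f (real (Suc n) * \<Delta>t))" for n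
  proof (rule backward_euler_step[OF U_L2 U_L2 _ time_step])
    show "f (real (Suc n) * \<Delta>t) \<in> L2 \<Omega>"
      using source by (metis le_add1 plus_1_eq_Suc)
    \<comment> \<open>\<open>U (Suc n)\<close> lies in \<open>Vms\<close>, so it is an admissible
      test function in the scheme at index \<open>Suc n\<close>.\<close>
    have "L2_inner \<Omega> (\<lambda>x. (U (Suc n) x - U (Suc n - 1) x) / \<Delta>t) (U (Suc n))
        + energy \<Omega> \<kappa> (U (Suc n)) (U (Suc n)) = L2_inner \<Omega> (f (real (Suc n) * \<Delta>t)) (U (Suc n))"
      using scheme U_in by (metis le_add1 plus_1_eq_Suc)
    then show "L2_inner \<Omega> (\<lambda>x. (U (Suc n) x - U n x) / \<Delta>t) (U (Suc n))
        \<le> L2_inner \<Omega> (f (real (Suc n) * \<Delta>t)) (U (Suc n))"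
      using energy[of "Suc n"] by simp
  qed
  have "L2_norm \<Omega> (U n)
      \<le> L2_norm \<Omega> (U 0) + \<Delta>t * (\<Sum>j=1..n. L2_norm \<Omega> (f (real j * \<Delta>t)))" for n
  \<comment> \<open>Starting at 0, where the sum is empty and the bound is an equality, lets every
    step use the scheme at an index of at least 1.\<close>
  proof (induction n)
    case 0
    then show ?case by simp
  next
    case (Suc n)
    then show ?case
      using step[of n] by (simp add: distrib_left)
  qed
  then show ?thesis by blast
qed

end
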